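(* The minimal non-NI reflexive ring is $M_2(\mathbb{F}_2)$; that is, $M_2(\mathbb{F}_2)$ is reflexive and not NI, every reflexive non-NI ring has order at least $|M_2(\mathbb{F}_2)|=16$, and, up to isomorphism, $M_2(\mathbb{F}_2)$ is the only reflexive non-NI ring of that order.
   Context: All rings are associative with unity. $M_2(\mathbb{F}_2)$ is the full $2\times 2$ matrix ring over $\mathbb{F}_2$. A ring $R$ is NI if its set $N(R)$ of nilpotent elements is a two-sided ideal (equivalently, $N(R)$ equals the upper nil radical of $R$); reflexive if for all $a,b\in R$, $aRb=0$ implies $bRa=0$. A minimal ring of a given type is a ring of that type of smallest possible order (cardinality). *)

theory Defs
  imports
    "HOL-Algebra.QuotRing"
    "HOL-Library.Z2"
    "HOL-Library.Equipollence"
    "Jordan_Normal_Form.Matrix"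
begin

definition nilpotents :: "('a, 'm) ring_scheme \<Rightarrow> 'a set" where
  "nilpotents R = {a \<in> carrier R. \<exists>n::nat. n > 0 \<and> a [^]\<^bsub>R\<^esub> n = \<zero>\<^bsub>R\<^esub>}"

text \<open>The locale \<^locale>\<open>ideal\<close> is about two-sided ideals of a ring that is associative and
  unital, but not necessarily commutative.\<close>

definition NI_ring :: "('a, 'm) ring_scheme \<Rightarrow> bool" where
  "NI_ring R \<longleftrightarrow> ring R \<and> ideal (nilpotents R) R"

definition reflexive_ring :: "('a, 'm) ring_scheme \<Rightarrow> bool" where
  "reflexive_ring R \<longleftrightarrow> ring R \<and>
     (\<forall>a \<in> carrier R. \<forall>b \<in> carrier R.
        (\<forall>r \<in> carrier R. a \<otimes>\<^bsub>R\<^esub> r \<otimes>\<^bsub>R\<^esub> b = \<zero>\<^bsub>R\<^esub>) \<longrightarrow>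
        (\<forall>r \<in> carrier R. b \<otimes>\<^bsub>R\<^esub> r \<otimes>\<^bsub>R\<^esub> a = \<zero>\<^bsub>R\<^esub>))"

text \<open>The type \<^typ>\<open>bit\<close> is the field with two elements. The last argument of
  \<^const>\<open>ring_mat\<close> only fills the extension slot of the ring record.\<close>

definition M2F2 :: "bit mat ring" where
  "M2F2 = ring_mat TYPE(bit) 2 ()"

end

theory Submission
  imports Defs
begin

text \<open>In a finite ring \<open>R\<close> the set
  \<open>J = {b. b R is nil}\<close> is an ideal, and if it contains every element of square zero, then it
  equals the set of nilpotents, so that \<open>R\<close> is NI. Otherwise \<open>b\<^sup>2 = 0\<close> for some \<open>b\<close> with
  \<open>b R\<close> not nil, and a power of a non-nilpotent element of \<open>b R\<close> is an idempotent
  \<open>e = b s \<noteq> 0\<close>. Then \<open>e\<close>, \<open>x = e b\<close>, \<open>y = (1 - e) s e\<close> and \<open>y x\<close> are matrix units, because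
  \<open>b e = b b s = 0\<close>. The combinations of these with coefficients \<open>0\<close> and \<open>1\<close> are 16 distinct elements;
  if they exhaust \<open>R\<close>, then \<open>2 e = 0\<close> and they multiply like binary matrices.\<close>

section \<open>Nilpotents of finite rings\<close>

text \<open>Two powers of \<open>c\<close> coincide, so the powers are periodic with some period
  \<open>d\<close> from an exponent \<open>m\<close> on. An exponent that is at least
  \<open>m\<close> and divisible by \<open>d\<close> may be doubled without changing the
  power.\<close>

lemma (in monoid) finite_idempotent_power:
  assumes fin: "finite (carrier G)" and c: "c \<in> carrier G"
  obtains k :: nat where "k > 0" and "c [^] k \<otimes> c [^] k = c [^] k"
proof -
  have "\<not> inj (\<lambda>n::nat. c [^] n)"
  proof
    assume "inj (\<lambda>n::nat. c [^] n)"
    then have "infinite (range (\<lambda>n::nat. c [^] n))" by (rule range_inj_infinite)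
    moreover have "range (\<lambda>n::nat. c [^] n) \<subseteq> carrier G" using c by (simp add: image_subset_iff)
    ultimately show False using fin by (simp add: finite_subset)
  qed
  then obtain m n :: nat where "m \<noteq> n" "c [^] m = c [^] n"
    by (auto simp: inj_on_def)
  then obtain m d :: nat where d: "d > 0" and md: "c [^] m = c [^] (m + d)"
  proof (cases "m < n")
    case True
    then show ?thesis using that[of "n - m" m] \<open>c [^] m = c [^] n\<close> by simp
  next
    case False
    then show ?thesis using that[of "m - n" n] \<open>c [^] m = c [^] n\<close> \<open>m \<noteq> n\<close> by simp
  qed
  have shift: "c [^] (m + j + d) = c [^] (m + j)" for j
  proof -
    have "c [^] (m + j + d) = c [^] (m + d) \<otimes> c [^] j"
      using c by (simp add: nat_pow_mult ac_simps)
    also have "\<dots> = c [^] m \<otimes> c [^] j" by (simp only: md[symmetric])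
    finally show ?thesis using c by (simp add: nat_pow_mult)
  qed
  have per: "c [^] (m + j + t * d) = c [^] (m + j)" for j t
  proof (induction t)
    case (Suc t)
    have "c [^] (m + j + Suc t * d) = c [^] (m + (j + t * d) + d)"
      by (simp add: algebra_simps)
    also have "\<dots> = c [^] (m + j + t * d)"
      by (simp only: shift) (simp add: add.assoc)
    finally show ?case using Suc.IH by simp
  qed simp
  \<comment> \<open>The factor \<open>Suc m\<close> instead of \<open>m\<close> keeps
    \<open>k\<close> positive when \<open>m = 0\<close>. Since \<open>k\<close> is
    \<open>Suc m\<close> periods, \<open>per\<close> with \<open>t = Suc m\<close> compares the
    exponents \<open>k + k\<close> and \<open>k\<close>.\<close>
  define k where "k = Suc m * d"
  have "m \<le> k" using d by (cases d) (simp_all add: k_def)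
  then obtain j where j: "k = m + j" using le_Suc_ex by blast
  have "c [^] (k + k) = c [^] k"
    using per[of j "Suc m"] unfolding j[symmetric] by (simp add: k_def)
  moreover have "k > 0" using d by (simp add: k_def)
  ultimately show ?thesis using that c by (simp add: nat_pow_mult)
qed

lemma (in monoid) idempotent_pow:
  assumes "e \<in> carrier G" "e \<otimes> e = e" "n > 0"
  shows "e [^] (n::nat) = e"
  using assms(3)
proof (induction n)
  case (Suc n)
  then show ?case using assms(1,2) by (cases n) auto
qed simp

lemma (in monoid) pow_mult_swap:
  assumes "a \<in> carrier G" "b \<in> carrier G"
  shows "(b \<otimes> a) [^] Suc n = b \<otimes> (a \<otimes> b) [^] n \<otimes> a"
proof (induction n)
  case (Suc n)
  have "(b \<otimes> a) [^] Suc (Suc n) = (b \<otimes> (a \<otimes> b) [^] n \<otimes> a) \<otimes> (b \<otimes> a)"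
    using Suc.IH by (simp only: nat_pow_Suc)
  then show ?case using assms by (simp add: m_assoc)
qed (use assms in simp)

text \<open>For a finite ring this is the Jacobson radical.\<close>

definition nil_radical :: "('a, 'm) ring_scheme \<Rightarrow> 'a set" where
  "nil_radical R = {b \<in> carrier R. \<forall>r \<in> carrier R. b \<otimes>\<^bsub>R\<^esub> r \<in> nilpotents R}"

context ring
begin

lemma nilpotents_swap:
  assumes "a \<in> carrier R" "b \<in> carrier R" "a \<otimes> b \<in> nilpotents R"
  shows "b \<otimes> a \<in> nilpotents R"
proof -
  obtain n :: nat where "n > 0" "(a \<otimes> b) [^] n = \<zero>"
    using assms(3) by (auto simp: nilpotents_def)
  then have "(b \<otimes> a) [^] Suc n = \<zero>"
    using assms(1,2) by (simp only: pow_mult_swap) simp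
  then show ?thesis using assms(1,2) unfolding nilpotents_def by blast
qed

lemma square_zero_nilpotent:
  assumes "a \<in> carrier R" "a \<otimes> a = \<zero>"
  shows "a \<in> nilpotents R"
proof -
  have "a [^] Suc (Suc 0) = \<zero>" using assms by simp
  then show ?thesis using assms(1) unfolding nilpotents_def by blast
qed

lemma nilpotent_idempotent:
  assumes "e \<in> nilpotents R" "e \<otimes> e = e"
  shows "e = \<zero>"
  using assms idempotent_pow[of e] by (auto simp: nilpotents_def)

lemma nil_radical_nilpotent: "nil_radical R \<subseteq> nilpotents R"
proof
  fix b assume "b \<in> nil_radical R"
  then have "b \<in> carrier R" "b \<otimes> \<one> \<in> nilpotents R" by (simp_all add: nil_radical_def del: r_one)
  then show "b \<in> nilpotents R" by simp
qed

text \<open>In the corner ring with identity \<open>e\<close>, the element \<open>p = e - q\<close>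
  is a unit because \<open>q\<close> is nilpotent. A nilpotent unit exists only in the zero
  ring.\<close>

lemma idempotent_sum_nilpotents:
  assumes e: "e \<in> carrier R" "e \<otimes> e = e"
    and p: "p \<in> nilpotents R" and q: "q \<in> nilpotents R"
    and ep: "e \<otimes> p = p" and qe: "q \<otimes> e = q" and eq: "e \<otimes> q = q" and sum: "e = p \<oplus> q"
  shows "e = \<zero>"
proof -
  have pc: "p \<in> carrier R" and qc: "q \<in> carrier R" using p q by (auto simp: nilpotents_def)
  obtain n :: nat where n: "p [^] n = \<zero>" using p by (auto simp: nilpotents_def)
  obtain m :: nat where m: "q [^] m = \<zero>" using q by (auto simp: nilpotents_def)
  \<comment> \<open>For \<open>z = q [^] j \<otimes> e\<close> the hypothesis says
    \<open>z \<otimes> q = \<zero>\<close>, so \<open>z = z \<otimes> e\<close> turns into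
    \<open>z = z \<otimes> p\<close>. Iterating this reaches the vanishing power of
    \<open>p\<close>.\<close>
  have step: "q [^] j \<otimes> e = \<zero>" if "q [^] Suc j \<otimes> e = \<zero>" for j
  proof -
    define z where "z = q [^] j \<otimes> e"
    have z: "z \<in> carrier R" using e qc by (simp add: z_def)
    have zq: "z \<otimes> q = \<zero>" using that e qc by (simp add: z_def m_assoc eq qe)
    have "z = z \<otimes> e" using e qc by (simp add: z_def m_assoc)
    also have "\<dots> = z \<otimes> p \<oplus> z \<otimes> q" using z pc qc by (subst sum) (simp add: r_distr)
    finally have zp: "z \<otimes> p = z" using zq z pc by simp
    have "z \<otimes> p [^] i = z" for i :: nat
      by (induction i) (use z pc zp in \<open>simp_all add: m_assoc[symmetric]\<close>)
    from this[of n] show ?thesis using n z by (simp add: z_def)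
  qed
  \<comment> \<open>The exponent descends from \<open>m\<close> to \<open>0\<close>, where the claim
    reads \<open>e = \<zero>\<close>; past \<open>m\<close> the truncated difference no longer
    changes.\<close>
  have "q [^] (m - i) \<otimes> e = \<zero>" for i
  proof (induction i)
    case 0
    show ?case using m e by simp
  next
    case (Suc i)
    show ?case
    proof (cases "i < m")
      case True
      then have "m - i = Suc (m - Suc i)" by simp
      then show ?thesis using step[of "m - Suc i"] Suc.IH by simp
    next
      case False
      then show ?thesis using Suc.IH by simp
    qed
  qed
  from this[of m] show ?thesis using e by simp
qed

text \<open>Some \<open>b \<otimes> r\<close> is not nilpotent, so its idempotent power is nonzero.
  That power has a positive exponent, hence starts with the factor \<open>b\<close>; the rest of it
  is \<open>s\<close>.\<close>

lemma not_nil_radical_idempotent: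
  assumes fin: "finite (carrier R)" and b: "b \<in> carrier R" "b \<notin> nil_radical R"
  obtains e s where "e \<in> carrier R" "s \<in> carrier R" "e \<noteq> \<zero>" "e \<otimes> e = e" "b \<otimes> s = e"
proof -
  obtain r where r: "r \<in> carrier R" "b \<otimes> r \<notin> nilpotents R"
    using b by (auto simp: nil_radical_def)
  obtain k :: nat where k: "k > 0" "(b \<otimes> r) [^] k \<otimes> (b \<otimes> r) [^] k = (b \<otimes> r) [^] k"
    using finite_idempotent_power[OF fin, of "b \<otimes> r"] b r by auto
  have "b \<otimes> (r \<otimes> (b \<otimes> r) [^] (k - 1)) = (b \<otimes> r) [^] k"
    using b r k nat_pow_Suc2[of "b \<otimes> r" "k - 1"] by (simp add: m_assoc)
  moreover have "(b \<otimes> r) [^] k \<noteq> \<zero>"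
    using r(2) k(1) b(1) r(1) unfolding nilpotents_def by blast
  ultimately show ?thesis
    using that[of "(b \<otimes> r) [^] k" "r \<otimes> (b \<otimes> r) [^] (k - 1)"] k b r by simp
qed

section \<open>The nil radical of a finite ring is an ideal\<close>

lemma nil_radical_mult_right:
  assumes "b \<in> nil_radical R" "t \<in> carrier R"
  shows "b \<otimes> t \<in> nil_radical R"
  using assms by (auto simp: nil_radical_def m_assoc)

text \<open>The nilpotent element \<open>b \<otimes> r \<otimes> t\<close> stays nilpotent when
  \<open>t\<close> is moved cyclically to the front.\<close>

lemma nil_radical_mult_left:
  assumes b: "b \<in> nil_radical R" and t: "t \<in> carrier R"
  shows "t \<otimes> b \<in> nil_radical R"
proof -
  have bc: "b \<in> carrier R" using b by (simp add: nil_radical_def)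
  have "t \<otimes> b \<otimes> r \<in> nilpotents R" if r: "r \<in> carrier R" for r
  proof -
    have "b \<otimes> r \<otimes> t \<in> nilpotents R" using b r t bc by (simp add: nil_radical_def m_assoc)
    then show ?thesis using nilpotents_swap[of "b \<otimes> r" t] bc r t by (simp add: m_assoc)
  qed
  then show ?thesis using bc t by (simp add: nil_radical_def)
qed

text \<open>Otherwise a nonzero idempotent \<open>e\<close> is a right multiple of
  \<open>a \<oplus> b\<close>. Multiplying by \<open>e\<close> on both sides writes \<open>e\<close>
  as a sum of two nilpotents of its corner, which is impossible.\<close>

lemma nil_radical_add:
  assumes fin: "finite (carrier R)" and a: "a \<in> nil_radical R" and b: "b \<in> nil_radical R"
  shows "a \<oplus> b \<in> nil_radical R"
proof (rule ccontr)
  assume not: "a \<oplus> b \<notin> nil_radical R"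
  have ac: "a \<in> carrier R" and bc: "b \<in> carrier R" using a b by (auto simp: nil_radical_def)
  obtain e s where e: "e \<in> carrier R" and s: "s \<in> carrier R" and e0: "e \<noteq> \<zero>"
    and ee: "e \<otimes> e = e" and es: "(a \<oplus> b) \<otimes> s = e"
    using not_nil_radical_idempotent[OF fin _ not] ac bc by auto
  define p q where "p = e \<otimes> (a \<otimes> s) \<otimes> e" and "q = e \<otimes> (b \<otimes> s) \<otimes> e"
  have "p \<in> nil_radical R" "q \<in> nil_radical R"
    unfolding p_def q_def using a b s e
    by (simp_all add: nil_radical_mult_left nil_radical_mult_right)
  then have nil: "p \<in> nilpotents R" "q \<in> nilpotents R" using nil_radical_nilpotent by auto
  have "p \<oplus> q = e \<otimes> ((a \<oplus> b) \<otimes> s) \<otimes> e"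
    using ac bc s e by (simp add: p_def q_def l_distr r_distr)
  then have sum: "e = p \<oplus> q" using es ee e by simp
  have abs: "e \<otimes> (e \<otimes> u) = e \<otimes> u" if "u \<in> carrier R" for u
    using that e ee m_assoc[of e e u] by simp
  have "e = \<zero>"
    by (rule idempotent_sum_nilpotents[OF e ee nil _ _ _ sum])
      (use ac bc s e ee in \<open>simp_all add: p_def q_def m_assoc abs\<close>)
  with e0 show False by simp
qed

lemma nil_radical_ideal:
  assumes fin: "finite (carrier R)"
  shows "ideal (nil_radical R) R"
proof (rule idealI[OF ring_axioms])
  show "subgroup (nil_radical R) (add_monoid R)"
  proof (rule subgroup.intro)
    show "nil_radical R \<subseteq> carrier (add_monoid R)" by (auto simp: nil_radical_def)
    show "x \<otimes>\<^bsub>add_monoid R\<^esub> y \<in> nil_radical R"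
      if "x \<in> nil_radical R" "y \<in> nil_radical R" for x y
      using nil_radical_add[OF fin that] by simp
    have "\<zero> \<in> nilpotents R" unfolding nilpotents_def by (auto intro!: exI[of _ "1::nat"])
    then show "\<one>\<^bsub>add_monoid R\<^esub> \<in> nil_radical R" by (simp add: nil_radical_def)
    show "inv\<^bsub>add_monoid R\<^esub> x \<in> nil_radical R" if "x \<in> nil_radical R" for x
    proof -
      have "x \<in> carrier R" using that by (simp add: nil_radical_def)
      then have "inv\<^bsub>add_monoid R\<^esub> x = x \<otimes> (\<ominus> \<one>)" by (simp add: a_inv_def[symmetric] r_minus)
      then show ?thesis using nil_radical_mult_right[OF that, of "\<ominus> \<one>"] by simp
    qed
  qed
qed (auto intro: nil_radical_mult_left nil_radical_mult_right)

text \<open>Modulo the radical, \<open>e c (1 - e)\<close> vanishes, so \<open>e c e\<close> is both invertible in the corner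
  of \<open>e\<close> and of square zero.\<close>

lemma nil_radical_square:
  assumes fin: "finite (carrier R)"
    and sq: "\<And>b. b \<in> carrier R \<Longrightarrow> b \<otimes> b = \<zero> \<Longrightarrow> b \<in> nil_radical R"
    and c: "c \<in> carrier R" "c \<otimes> c \<in> nil_radical R"
  shows "c \<in> nil_radical R"
proof (rule ccontr)
  assume "c \<notin> nil_radical R"
  then obtain e s where e: "e \<in> carrier R" and s: "s \<in> carrier R" and e0: "e \<noteq> \<zero>"
    and ee: "e \<otimes> e = e" and es: "c \<otimes> s = e"
    using not_nil_radical_idempotent[OF fin c(1)] by metis
  interpret I: ideal "nil_radical R" R by (rule nil_radical_ideal[OF fin])
  define f where "f = \<one> \<ominus> e"
  have f: "f \<in> carrier R" using e by (simp add: f_def)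
  have fe: "f \<otimes> e = \<zero>" and ef1: "e \<oplus> f = \<one>"
    using e ee by (simp_all add: f_def minus_eq l_distr l_minus r_neg a_lcomm[of e \<one>])
  define x where "x = e \<otimes> c \<otimes> f"
  define u where "u = e \<otimes> c \<otimes> e"
  have xc: "x \<in> carrier R" and uc: "u \<in> carrier R" using e c f by (simp_all add: x_def u_def)
  \<comment> \<open>The inner factor \<open>f \<otimes> e\<close> is zero, so \<open>sq\<close> puts
    \<open>x\<close> into the radical. Modulo the radical \<open>u\<close> therefore equals
    \<open>e \<otimes> c\<close>, with right multiple \<open>e\<close>.\<close>
  have "x \<otimes> x = e \<otimes> c \<otimes> (f \<otimes> e) \<otimes> (c \<otimes> f)"
    using e c f by (simp add: x_def m_assoc)
  then have xI: "x \<in> nil_radical R" using fe e c f xc by (intro sq) simp_all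
  have ux: "u \<oplus> x = e \<otimes> c"
    using e c f ef1 r_distr[of e f "e \<otimes> c"] by (simp add: u_def x_def)
  have e_eq: "e = u \<otimes> s \<oplus> x \<otimes> s"
  proof -
    have "u \<otimes> s \<oplus> x \<otimes> s = (u \<oplus> x) \<otimes> s" using uc xc s by (simp add: l_distr)
    also have "\<dots> = e" using ux es ee e c s by (simp add: m_assoc)
    finally show ?thesis by simp
  qed
  have ue: "u \<otimes> e = u" using e c ee by (simp add: u_def m_assoc)
  \<comment> \<open>As \<open>u \<otimes> e = u\<close>, the square of \<open>u\<close> is
    \<open>u \<otimes> (c \<otimes> e)\<close>; replacing its left factor by
    \<open>u \<oplus> x\<close> adds only a radical term.\<close>
  have uu: "u \<otimes> u \<oplus> x \<otimes> (c \<otimes> e) = e \<otimes> (c \<otimes> c) \<otimes> e"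
  proof -
    have "u \<otimes> u = u \<otimes> (c \<otimes> e)" using e c uc ue m_assoc[of u e "c \<otimes> e"] by (simp add: u_def m_assoc)
    then have "u \<otimes> u \<oplus> x \<otimes> (c \<otimes> e) = (u \<oplus> x) \<otimes> (c \<otimes> e)"
      using uc xc c e by (simp add: l_distr)
    also have "\<dots> = e \<otimes> (c \<otimes> c) \<otimes> e" using ux e c by (simp add: m_assoc)
    finally show ?thesis .
  qed
  have "u \<otimes> u = e \<otimes> (c \<otimes> c) \<otimes> e \<ominus> x \<otimes> (c \<otimes> e)"
    unfolding uu[symmetric] using uc xc c e by (simp add: minus_eq a_assoc r_neg)
  moreover have "e \<otimes> (c \<otimes> c) \<otimes> e \<in> nil_radical R" "x \<otimes> (c \<otimes> e) \<in> nil_radical R"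
    using c e xI by (simp_all add: nil_radical_mult_left nil_radical_mult_right)
  ultimately have uuI: "u \<otimes> u \<in> nil_radical R"
    unfolding minus_eq by simp
  \<comment> \<open>Inserting the decomposition of \<open>e\<close> into
    \<open>u = u \<otimes> e\<close> makes every term contain \<open>u \<otimes> u\<close> or
    \<open>x\<close>.\<close>
  have "u = u \<otimes> (u \<otimes> s \<oplus> x \<otimes> s)" using ue by (simp flip: e_eq)
  also have "\<dots> = u \<otimes> u \<otimes> s \<oplus> u \<otimes> x \<otimes> s" using uc xc s by (simp add: m_assoc r_distr)
  also have "\<dots> \<in> nil_radical R"
    using uuI xI uc s by (simp add: nil_radical_mult_left nil_radical_mult_right)
  finally have uI: "u \<in> nil_radical R" .
  have "e \<in> nil_radical R"
    unfolding e_eq using uI xI s by (simp add: nil_radical_mult_right)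
  then show False using nil_radical_nilpotent nilpotent_idempotent[OF _ ee] e0 by auto
qed

text \<open>If \<open>c\<close> is nilpotent, then \<open>c [^] (2 ^ n)\<close> is zero for some
  \<open>n\<close>. Taking the square root \<open>n\<close> times with
  \<open>nil_radical_square\<close> leads back to \<open>c\<close>.\<close>

lemma nilpotents_eq_nil_radical:
  assumes fin: "finite (carrier R)"
    and sq: "\<And>b. b \<in> carrier R \<Longrightarrow> b \<otimes> b = \<zero> \<Longrightarrow> b \<in> nil_radical R"
  shows "nilpotents R = nil_radical R"
proof
  have desc: "c \<in> nil_radical R" if "c \<in> carrier R" "c [^] ((2::nat) ^ n) \<in> nil_radical R" for c n
    using that
  proof (induction n)
    case (Suc n)
    have "c [^] ((2::nat) ^ n) \<otimes> c [^] ((2::nat) ^ n) \<in> nil_radical R"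
      using Suc.prems by (simp add: nat_pow_mult mult_2)
    then show ?case using Suc nil_radical_square[OF fin sq] by blast
  qed simp
  show "nilpotents R \<subseteq> nil_radical R"
  proof
    fix c assume "c \<in> nilpotents R"
    then obtain n :: nat where c: "c \<in> carrier R" and n: "c [^] n = \<zero>"
      by (auto simp: nilpotents_def)
    have "n \<le> 2 ^ n" by (simp add: less_imp_le)
    then have "c [^] ((2::nat) ^ n) = c [^] n \<otimes> c [^] (2 ^ n - n)"
      using c by (simp add: nat_pow_mult)
    also have "\<dots> = \<zero>" using n c by simp
    finally have z: "c [^] ((2::nat) ^ n) = \<zero>" .
    have "\<zero> \<in> nil_radical R" by (rule sq) simp_all
    then show "c \<in> nil_radical R" using desc[OF c, of n] z by simp
  qed
qed (rule nil_radical_nilpotent)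

text \<open>If all elements of square zero lay in the nil radical, the nilpotents would form an
  ideal; this yields \<open>b\<close>. The factor \<open>f = \<one> \<ominus> e\<close> in
  \<open>y\<close> forces \<open>e \<otimes> y = \<zero>\<close> and does not disturb
  \<open>x \<otimes> y = e\<close>, because \<open>b \<otimes> f = b\<close>.\<close>

lemma not_NI_matrix_units:
  assumes fin: "finite (carrier R)" and not: "\<not> NI_ring R"
  obtains e x y where "e \<in> carrier R" "x \<in> carrier R" "y \<in> carrier R" "e \<noteq> \<zero>"
    "e \<otimes> e = e" "e \<otimes> x = x" "x \<otimes> e = \<zero>" "y \<otimes> e = y" "e \<otimes> y = \<zero>" "x \<otimes> y = e"
proof -
  have "\<not> ideal (nilpotents R) R" using not ring_axioms by (simp add: NI_ring_def)
  then obtain b where b: "b \<in> carrier R" "b \<notin> nil_radical R" and bb: "b \<otimes> b = \<zero>"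
    using nilpotents_eq_nil_radical[OF fin] nil_radical_ideal[OF fin] by metis
  obtain e s where e: "e \<in> carrier R" and s: "s \<in> carrier R" and e0: "e \<noteq> \<zero>"
    and ee: "e \<otimes> e = e" and es: "b \<otimes> s = e"
    using not_nil_radical_idempotent[OF fin b] by metis
  have be: "b \<otimes> e = \<zero>" using bb b s es by (metis l_null m_assoc)
  define f where "f = \<one> \<ominus> e"
  have f: "f \<in> carrier R" using e by (simp add: f_def)
  have ef: "e \<otimes> f = \<zero>" using e ee by (simp add: f_def minus_eq r_distr r_minus r_neg)
  have bf: "b \<otimes> f = b" using e b be by (simp add: f_def minus_eq r_distr r_minus)
  show ?thesis
  proof (rule that[of e "e \<otimes> b" "f \<otimes> s \<otimes> e"])
    show "e \<otimes> b \<otimes> (f \<otimes> s \<otimes> e) = e"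
    proof -
      have "e \<otimes> b \<otimes> (f \<otimes> s \<otimes> e) = e \<otimes> ((b \<otimes> f) \<otimes> s) \<otimes> e"
        using e b f s by (simp add: m_assoc)
      then show ?thesis using bf es ee by simp
    qed
    show "e \<otimes> (f \<otimes> s \<otimes> e) = \<zero>"
      using ef e f s m_assoc[of e f "s \<otimes> e"] by (simp add: m_assoc)
    show "e \<otimes> (e \<otimes> b) = e \<otimes> b" using ee e b m_assoc[of e e b] by simp
    show "e \<otimes> b \<otimes> e = \<zero>" using be e b by (simp add: m_assoc)
    show "f \<otimes> s \<otimes> e \<otimes> e = f \<otimes> s \<otimes> e" using ee e f s by (simp add: m_assoc)
  qed (use e b f s e0 ee in simp_all)
qed

end

section \<open>Matrix units and binary matrices\<close>

text \<open>A case distinction makes sense in every ring, even if the characteristic is not two. It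
  is additive in the bit only for \<open>u\<close> with
  \<open>u \<oplus> u = \<zero>\<close>.\<close>

definition bit_scale :: "('a, 'm) ring_scheme \<Rightarrow> bit \<Rightarrow> 'a \<Rightarrow> 'a" where
  "bit_scale R a u = (if a = 1 then u else \<zero>\<^bsub>R\<^esub>)"

definition units_map :: "('a, 'm) ring_scheme \<Rightarrow> 'a \<Rightarrow> 'a \<Rightarrow> 'a \<Rightarrow> 'a \<Rightarrow> bit mat \<Rightarrow> 'a" where
  "units_map R e x y g A = bit_scale R (A $$ (0,0)) e \<oplus>\<^bsub>R\<^esub> (bit_scale R (A $$ (0,1)) x \<oplus>\<^bsub>R\<^esub>
     (bit_scale R (A $$ (1,0)) y \<oplus>\<^bsub>R\<^esub> bit_scale R (A $$ (1,1)) g))"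

context ring
begin

lemma bit_scale_closed [simp]: "u \<in> carrier R \<Longrightarrow> bit_scale R a u \<in> carrier R"
  by (simp add: bit_scale_def)

lemma bit_scale_zero [simp]: "bit_scale R a \<zero> = \<zero>"
  by (simp add: bit_scale_def)

lemma bit_scale_mult:
  assumes "u \<in> carrier R" "v \<in> carrier R"
  shows "bit_scale R a u \<otimes> bit_scale R b v = bit_scale R (a * b) (u \<otimes> v)"
  using assms by (auto simp: bit_scale_def)

lemma mult_bit_scale:
  assumes "u \<in> carrier R" "v \<in> carrier R"
  shows "u \<otimes> bit_scale R b v = bit_scale R b (u \<otimes> v)" "bit_scale R b u \<otimes> v = bit_scale R b (u \<otimes> v)"
  using assms by (auto simp: bit_scale_def)

lemma bit_scale_add:
  assumes "u \<in> carrier R" "u \<oplus> u = \<zero>"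
  shows "bit_scale R (a + b) u = bit_scale R a u \<oplus> bit_scale R b u"
  using assms by (cases "a = 0"; cases "b = 0") (auto simp: bit_scale_def)

end

lemma mat_2_mult_index:
  assumes "A \<in> carrier_mat 2 2" "B \<in> carrier_mat 2 2" "i < 2" "j < 2"
  shows "(A * B) $$ (i, j) = A $$ (i, 0) * B $$ (0, j) + A $$ (i, 1) * B $$ (1, j)"
  using assms by (simp add: scalar_prod_def numeral_2_eq_2)

lemma mat_2_eqI:
  assumes "A \<in> carrier_mat 2 2" "B \<in> carrier_mat 2 2"
    and "A $$ (0,0) = B $$ (0,0)" "A $$ (0,1) = B $$ (0,1)"
      "A $$ (1,0) = B $$ (1,0)" "A $$ (1,1) = B $$ (1,1)"
  shows "A = B"
  using assms by (intro eq_matI) (auto simp: less_2_cases_iff)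

text \<open>The elements \<open>e\<close>, \<open>x\<close>, \<open>y\<close>, \<open>g\<close>
  multiply like the elementary matrices at (0,0), (0,1), (1,0), (1,1). Their span may be smaller
  than \<open>R\<close>, and \<open>e \<oplus> g\<close> may differ from
  \<open>\<one>\<close>.\<close>

locale matrix_units = ring R for R (structure) +
  fixes e x y g
  assumes closed [simp]: "e \<in> carrier R" "x \<in> carrier R" "y \<in> carrier R" "g \<in> carrier R"
    and nonzero: "e \<noteq> \<zero>"
    and e_mult [simp]: "e \<otimes> e = e" "e \<otimes> x = x" "e \<otimes> y = \<zero>" "e \<otimes> g = \<zero>"
    and x_mult [simp]: "x \<otimes> e = \<zero>" "x \<otimes> x = \<zero>" "x \<otimes> y = e" "x \<otimes> g = x"
    and y_mult [simp]: "y \<otimes> e = y" "y \<otimes> x = g" "y \<otimes> y = \<zero>" "y \<otimes> g = \<zero>"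
    and g_mult [simp]: "g \<otimes> e = \<zero>" "g \<otimes> x = \<zero>" "g \<otimes> y = y" "g \<otimes> g = g"
begin

abbreviation \<phi> :: "bit mat \<Rightarrow> 'a" where "\<phi> \<equiv> units_map R e x y g"

lemma units_map_closed: "\<phi> A \<in> carrier R"
  by (simp add: units_map_def)

text \<open>The left factor selects a row and the right factor a column, and together they move the
  chosen entry to the corner of \<open>e\<close>. So every coefficient can be read off, which gives
  injectivity.\<close>

lemma units_map_entries:
  shows "e \<otimes> \<phi> A \<otimes> e = bit_scale R (A $$ (0,0)) e"
    and "e \<otimes> \<phi> A \<otimes> y = bit_scale R (A $$ (0,1)) e"
    and "x \<otimes> \<phi> A \<otimes> e = bit_scale R (A $$ (1,0)) e"
    and "x \<otimes> \<phi> A \<otimes> y = bit_scale R (A $$ (1,1)) e"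
  by (simp_all add: units_map_def r_distr l_distr mult_bit_scale)

lemma bit_scale_inject: "bit_scale R a e = bit_scale R b e \<longleftrightarrow> a = b"
  using nonzero by (cases "a = 0"; cases "b = 0") (auto simp: bit_scale_def)

lemma units_map_inj: "inj_on \<phi> (carrier_mat 2 2)"
proof (rule inj_onI)
  fix A B :: "bit mat"
  assume c: "A \<in> carrier_mat 2 2" "B \<in> carrier_mat 2 2" and eq: "\<phi> A = \<phi> B"
  show "A = B"
    using units_map_entries[of A, unfolded eq units_map_entries] c
    by (intro mat_2_eqI) (simp_all add: bit_scale_inject)
qed

lemma units_map_ring_iso:
  assumes surj: "\<phi> ` carrier_mat 2 2 = carrier R"
  shows "\<phi> \<in> ring_iso M2F2 R"
proof -
  \<comment> \<open>Surjectivity forces characteristic two: the (0,0) coefficient of a preimage of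
    \<open>e \<oplus> e\<close> leaves only the values \<open>e\<close> and \<open>\<zero>\<close>,
    and the first would give \<open>e = \<zero>\<close>.\<close>
  have "e \<oplus> e \<in> \<phi> ` carrier_mat 2 2" using surj by simp
  then obtain A where A: "\<phi> A = e \<oplus> e" by auto
  have "bit_scale R (A $$ (0,0)) e = e \<oplus> e"
    using units_map_entries(1)[of A] unfolding A by (simp add: l_distr r_distr)
  then have "e \<oplus> e = e \<or> e \<oplus> e = \<zero>" by (metis bit_scale_def)
  then have e2: "e \<oplus> e = \<zero>" using nonzero add.r_cancel_one[of e e] by simp
  \<comment> \<open>The other units inherit this through \<open>x = e \<otimes> x\<close>,
    \<open>y = y \<otimes> e\<close> and \<open>g = y \<otimes> x\<close>.\<close>
  have x2: "x \<oplus> x = \<zero>" using e2 l_distr[of e e x] by simp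
  have y2: "y \<oplus> y = \<zero>" using e2 r_distr[of e e y] by simp
  have g2: "g \<oplus> g = \<zero>" using x2 r_distr[of x x y] by simp
  have add: "\<phi> (A + B) = \<phi> A \<oplus> \<phi> B" if "A \<in> carrier_mat 2 2" "B \<in> carrier_mat 2 2" for A B
    using that by (simp add: units_map_def bit_scale_add e2 x2 y2 g2 a_ac del: add_bit_eq_xor)
  have mult: "\<phi> (A * B) = \<phi> A \<otimes> \<phi> B" if "A \<in> carrier_mat 2 2" "B \<in> carrier_mat 2 2" for A B
    using that
    by (simp add: units_map_def mat_2_mult_index bit_scale_add bit_scale_mult e2 x2 y2 g2 l_distr r_distr a_ac
        del: add_bit_eq_xor mult_bit_eq_and index_mult_mat)
  \<comment> \<open>A multiplicative surjection preserves the identity: multiply the image of the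
    identity by \<open>\<one>\<close>, written as \<open>\<phi> A\<close>.\<close>
  have one: "\<phi> (1\<^sub>m 2) = \<one>"
  proof -
    have "\<one> \<in> \<phi> ` carrier_mat 2 2" using surj by simp
    then obtain A where A: "A \<in> carrier_mat 2 2" "\<phi> A = \<one>" by auto
    then have "\<phi> (1\<^sub>m 2) = \<phi> (1\<^sub>m 2) \<otimes> \<phi> A" by (simp add: units_map_closed)
    also have "\<dots> = \<phi> (1\<^sub>m 2 * A)" using A mult[of "1\<^sub>m 2" A] by simp
    also have "\<dots> = \<one>" using A by simp
    finally show ?thesis .
  qed
  show ?thesis
    by (rule ring_iso_memI)
      (use add mult one surj units_map_inj in
        \<open>simp_all add: M2F2_def ring_mat_simps units_map_closed bij_betw_def\<close>)
qed

end

text \<open>With \<open>g = y \<otimes> x\<close>, associativity derives the whole multiplication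
  table from the six relations already found.\<close>

lemma (in ring) not_NI_matrix_units_locale:
  assumes "finite (carrier R)" "\<not> NI_ring R"
  obtains e x y g where "matrix_units R e x y g"
proof -
  obtain e x y where c: "e \<in> carrier R" "x \<in> carrier R" "y \<in> carrier R" "e \<noteq> \<zero>"
    and m: "e \<otimes> e = e" "e \<otimes> x = x" "x \<otimes> e = \<zero>" "y \<otimes> e = y" "e \<otimes> y = \<zero>" "x \<otimes> y = e"
    using not_NI_matrix_units[OF assms] by metis
  have xx: "x \<otimes> x = \<zero>" using c m m_assoc[of x e x] by simp
  have yy: "y \<otimes> y = \<zero>" using c m m_assoc[of y e y] by simp
  have "matrix_units R e x y (y \<otimes> x)"
  \<comment> \<open>The numbered goals are products with a factor \<open>y \<otimes> x\<close>,
    rebracketed until a known relation applies.\<close>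
  proof (unfold_locales, goal_cases)
    case 9 show ?case using c m m_assoc[of e y x] by simp
  next
    case 13 show ?case using c m m_assoc[of x y x] by simp
  next
    case 17 show ?case using c m yy m_assoc[of y y x] by simp
  next
    case 18 show ?case using c m m_assoc[of y x e] by simp
  next
    case 19 show ?case using c m xx m_assoc[of y x x] by simp
  next
    case 20 show ?case using c m m_assoc[of y x y] by simp
  next
    case 21 show ?case using c m m_assoc[of y x "y \<otimes> x"] m_assoc[of x y x] by simp
  qed (use c m xx yy in simp_all)
  then show ?thesis by (rule that)
qed

section \<open>The ring of binary matrices of size two\<close>

text \<open>Listing the entries reduces matrix identities to equations between bits.\<close>

definition mat2 :: "bit \<Rightarrow> bit \<Rightarrow> bit \<Rightarrow> bit \<Rightarrow> bit mat" where
  "mat2 p q r s = mat 2 2 (\<lambda>(i, j). if i = 0 then (if j = 0 then p else q) else (if j = 0 then r else s))"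

lemma mat2_carrier [simp]: "mat2 p q r s \<in> carrier_mat 2 2"
  by (simp add: mat2_def)

lemma mat2_index [simp]:
  "mat2 p q r s $$ (0,0) = p" "mat2 p q r s $$ (0,Suc 0) = q"
  "mat2 p q r s $$ (Suc 0,0) = r" "mat2 p q r s $$ (Suc 0,Suc 0) = s"
  by (simp_all add: mat2_def)

lemma mat2_mult:
  "mat2 p q r s * mat2 p' q' r' s' =
    mat2 (p * p' + q * r') (p * q' + q * s') (r * p' + s * r') (r * q' + s * s')"
  by (rule mat_2_eqI)
    (simp_all add: mat_2_mult_index mult_carrier_mat[OF mat2_carrier mat2_carrier] del: index_mult_mat)

lemma mat2_zero: "0\<^sub>m 2 2 = mat2 0 0 0 0"
  by (rule mat_2_eqI) simp_all

lemma mat2_eq_iff: "mat2 p q r s = mat2 p' q' r' s' \<longleftrightarrow> p = p' \<and> q = q' \<and> r = r' \<and> s = s'"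
  by (metis mat2_index)

lemma carrier_mat2_cases:
  assumes "A \<in> carrier_mat 2 2"
  obtains p q r s where "A = mat2 p q r s"
proof
  show "A = mat2 (A $$ (0,0)) (A $$ (0,1)) (A $$ (1,0)) (A $$ (1,1))"
    by (rule mat_2_eqI) (use assms in simp_all)
qed

lemma ring_M2F2: "ring M2F2"
  unfolding M2F2_def by (rule ring_mat)

lemma M2F2_simps:
  "carrier M2F2 = carrier_mat 2 2" "monoid.mult M2F2 = (*)" "ring.add M2F2 = (+)"
  "ring.zero M2F2 = 0\<^sub>m 2 2" "monoid.one M2F2 = 1\<^sub>m 2"
  by (simp_all add: M2F2_def ring_mat_simps)

lemma card_carrier_M2F2: "finite (carrier M2F2)" "card (carrier M2F2) = 16"
proof -
  let ?f = "\<lambda>(p, q, r, s). mat2 p q r s"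
  have U: "(UNIV :: bit set) = {0, 1}"
    using bit_not_zero_iff by blast
  have fin: "finite (UNIV :: bit set)" and card: "card (UNIV :: bit set) = 2"
    by (simp_all add: U)
  have "inj ?f"
    by (simp add: inj_def mat2_eq_iff)
  moreover have "range ?f = carrier M2F2"
  proof
    show "carrier M2F2 \<subseteq> range ?f"
    proof
      fix A assume "A \<in> carrier M2F2"
      then obtain p q r s where "A = mat2 p q r s"
        unfolding M2F2_simps by (rule carrier_mat2_cases)
      then show "A \<in> range ?f"
        by (intro image_eqI[of _ _ "(p, q, r, s)"]) simp_all
    qed
  qed (auto simp: M2F2_simps)
  ultimately have bij: "bij_betw ?f UNIV (carrier M2F2)"
    by (simp add: bij_betw_def)
  from bij_betw_finite[OF bij] show "finite (carrier M2F2)"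
    using fin by (simp add: finite_Prod_UNIV)
  from bij_betw_same_card[OF bij] show "card (carrier M2F2) = 16"
    using card by (simp add: card_cartesian_product flip: UNIV_Times_UNIV)
qed

text \<open>The ring is prime: if \<open>A\<close> and \<open>B\<close> have nonzero entries \<open>(i, j)\<close> and \<open>(k, l)\<close>, then
  the entry \<open>(i, l)\<close> of \<open>A E\<^sub>j\<^sub>k B\<close> is nonzero.\<close>

lemma reflexive_M2F2: "reflexive_ring M2F2"
proof -
  have prime: "A = 0\<^sub>m 2 2 \<or> B = 0\<^sub>m 2 2"
    if AB: "A \<in> carrier_mat 2 2" "B \<in> carrier_mat 2 2"
      and ann: "\<forall>C \<in> carrier_mat 2 2. A * C * B = 0\<^sub>m 2 2" for A B :: "bit mat"
  proof -
    obtain p q r s where A: "A = mat2 p q r s" using AB(1) by (rule carrier_mat2_cases)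
    obtain p' q' r' s' where B: "B = mat2 p' q' r' s'" using AB(2) by (rule carrier_mat2_cases)
    \<comment> \<open>The entries of these four products are all products of an entry of
      \<open>A\<close> with an entry of \<open>B\<close>.\<close>
    have "A * mat2 1 0 0 0 * B = 0\<^sub>m 2 2" "A * mat2 0 1 0 0 * B = 0\<^sub>m 2 2"
      "A * mat2 0 0 1 0 * B = 0\<^sub>m 2 2" "A * mat2 0 0 0 1 * B = 0\<^sub>m 2 2"
      using ann by simp_all
    then show ?thesis
      unfolding A B mat2_zero mat2_mult mat2_eq_iff by auto
  qed
  show ?thesis
    unfolding reflexive_ring_def M2F2_simps
  proof (intro conjI ballI impI ring_M2F2)
    fix A B C :: "bit mat"
    assume c: "A \<in> carrier_mat 2 2" "B \<in> carrier_mat 2 2" "C \<in> carrier_mat 2 2"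
      and ann: "\<forall>r \<in> carrier_mat 2 2. A * r * B = 0\<^sub>m 2 2"
    then show "B * C * A = 0\<^sub>m 2 2"
      using prime[OF c(1,2) ann] mult_carrier_mat[OF c(2,3)] by auto
  qed
qed

text \<open>An ideal containing the nilpotent matrix unit at (0,1) also contains its product with
  the one at (1,0), a nonzero idempotent.\<close>

lemma not_NI_M2F2: "\<not> NI_ring M2F2"
proof
  assume "NI_ring M2F2"
  then interpret I: ideal "nilpotents M2F2" M2F2 by (simp add: NI_ring_def)
  have "mat2 0 1 0 0 \<in> nilpotents M2F2"
    by (rule I.square_zero_nilpotent) (simp_all add: M2F2_simps mat2_mult mat2_zero)
  then have "mat2 0 1 0 0 \<otimes>\<^bsub>M2F2\<^esub> mat2 0 0 1 0 \<in> nilpotents M2F2"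
    by (rule I.I_r_closed) (simp add: M2F2_simps)
  then have "mat2 1 0 0 0 \<in> nilpotents M2F2"
    by (simp add: M2F2_simps mat2_mult)
  then have "mat2 1 0 0 0 = \<zero>\<^bsub>M2F2\<^esub>"
    by (rule I.nilpotent_idempotent) (simp add: M2F2_simps mat2_mult)
  then show False by (simp add: M2F2_simps mat2_zero mat2_eq_iff)
qed

section \<open>Lower bound on the order and uniqueness\<close>

text \<open>In the finite case the map \<open>\<phi>\<close> of a system of matrix units is an
  injection; an infinite carrier receives an injection from any finite set.\<close>

lemma not_NI_order_ge:
  assumes "ring R" "\<not> NI_ring R"
  shows "carrier M2F2 \<lesssim> carrier R"
proof (cases "finite (carrier R)")
  case True
  interpret ring R by fact
  obtain e x y g where "matrix_units R e x y g"
    using not_NI_matrix_units_locale[OF True assms(2)] .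
  then interpret matrix_units R e x y g .
  show ?thesis
    unfolding lepoll_def M2F2_simps using units_map_inj units_map_closed by blast
next
  case False
  then show ?thesis using card_carrier_M2F2(1) finite_lepoll_infinite by blast
qed

text \<open>An injection between finite sets of equal size is onto, so \<open>\<phi>\<close> is an
  isomorphism from \<open>M2F2\<close> to \<open>R\<close>, which is then inverted.\<close>

lemma not_NI_order_eq_iso:
  assumes "ring R" "\<not> NI_ring R" and eq: "carrier R \<approx> carrier M2F2"
  shows "R \<simeq> M2F2"
proof -
  interpret ring R by fact
  have fin: "finite (carrier R)" using eq card_carrier_M2F2(1) eqpoll_finite_iff by blast
  have card: "card (carrier R) = card (carrier M2F2)"
    using eq bij_betw_same_card unfolding eqpoll_def by blast
  obtain e x y g where "matrix_units R e x y g"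
    using not_NI_matrix_units_locale[OF fin assms(2)] .
  then interpret matrix_units R e x y g .
  have "\<phi> ` carrier_mat 2 2 = carrier R"
    using card units_map_closed units_map_inj
    by (intro card_subset_eq[OF fin]) (auto simp: card_image M2F2_simps)
  then show ?thesis
    using ring_iso_set_sym[OF ring_M2F2 units_map_ring_iso] by (auto simp: is_ring_iso_def)
qed

theorem theorem3p15:
  shows "ring M2F2 \<and> reflexive_ring M2F2 \<and> \<not> NI_ring M2F2
    \<and> finite (carrier M2F2) \<and> card (carrier M2F2) = 16
    \<and> (\<forall>R :: ('a, 'm) ring_scheme. ring R \<and> reflexive_ring R \<and> \<not> NI_ring R \<longrightarrow>
          carrier M2F2 \<lesssim> carrier R)
    \<and> (\<forall>R :: ('a, 'm) ring_scheme. ring R \<and> reflexive_ring R \<and> \<not> NI_ring R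
          \<and> carrier R \<approx> carrier M2F2 \<longrightarrow> R \<simeq> M2F2)"
  using ring_M2F2 reflexive_M2F2 not_NI_M2F2 card_carrier_M2F2 not_NI_order_ge not_NI_order_eq_iso
  by blast

end
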